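(* Let $W\ge 1$ and $\gamma\ge 1$ be real numbers, let $p\in[1,\infty)$ and let $L\ge 0$ be an integer. Then the set $\Lambda(S_L)\subseteq L^p(\Omega)$ has at least one Pareto optimal element: there exists $C^*\in S_L$ such that there is no $C\in S_L$ with $\Lambda C\preceq\Lambda C^*$ and $\Lambda C\neq\Lambda C^*$.
   Context: The Fourier transform is $\widehat{f}(x)=\int_{\mathbb{R}}f(t)e^{-2\pi i xt}\,dt$. $I_W=[-W,W]$; $L^2(I_W)$ is the space of complex-valued square-integrable functions on $I_W$, extended by zero to $\mathbb{R}$. $\Omega=[-\tfrac12,\tfrac12)$ with Lebesgue measure, and $L^p(\Omega)$ is the space of real-valued functions on $\Omega$ with finite $p$-norm, partially ordered by $f\preceq g$ iff $f(x)\le g(x)$ for almost every $x$. For $C\in L^2(I_W)$ with $\|C\|_2=1$, $$\Lambda C(x)=\frac{\sum_{m\in\mathbb{Z},\,m\neq 0}|\widehat{C}(x/\gamma+m)|^2}{\sum_{m\in\mathbb{Z}}|\widehat{C}(x/\gamma+m)|^2}\qquad(\text{for almost every }x\in\Omega).$$ Let $\psi_0,\psi_1,\dots$ be the prolate spheroidal wave functions (Slepian basis) on $I_W$ for the band $[-\tfrac12,\tfrac12]$, i.e. the real eigenfunctions of the integral operator $f\mapsto\int_{-W}^{W}\frac{\sin(\pi(t-s))}{\pi(t-s)}f(s)\,ds$ on $L^2(I_W)$, ordered by strictly decreasing eigenvalues; they are orthogonal and complete in $L^2(I_W)$. $H_L\subseteq L^2(I_W)$ is the complex linear span of $\psi_0,\dots,\psi_L$,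 and $S_L=\{C\in H_L:\|C\|_2=1\}$. *)

theory Defs
  imports "HOL-Analysis.Analysis" "HOL-Probability.Sinc_Integral"
begin

text \<open>Elements of an $L^p$ space are represented by functions; equality of classes is
  equality almost everywhere.\<close>

definition Lp_norm :: "real \<Rightarrow> 'a measure \<Rightarrow> ('a \<Rightarrow> 'b::{banach, second_countable_topology}) \<Rightarrow> real"
  where "Lp_norm p M f = (LINT x|M. norm (f x) powr p) powr (1 / p)"

definition Lp_space :: "real \<Rightarrow> 'a measure \<Rightarrow> ('a \<Rightarrow> 'b::{banach, second_countable_topology}) set"
  where "Lp_space p M = {f \<in> borel_measurable M. integrable M (\<lambda>x. norm (f x) powr p)}"

definition L2_I :: "real \<Rightarrow> (real \<Rightarrow> complex) set"
  where "L2_I W = {f \<in> Lp_space 2 lebesgue. \<forall>t. t \<notin> {-W..W} \<longrightarrow> f t = 0}"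

definition fourier :: "(real \<Rightarrow> complex) \<Rightarrow> real \<Rightarrow> complex"
  where "fourier f x =
    (LINT t|lebesgue. f t * exp (- (2 * complex_of_real pi * \<i> * complex_of_real x * complex_of_real t)))"

abbreviation Omega :: "real measure"
  where "Omega \<equiv> lebesgue_on {-1/2..<1/2}"

text \<open>For \<open>C \<in> L2_I W\<close> both series converge for every \<open>x\<close>, so \<open>infsum\<close> has its
  intended value. The denominator vanishes at most on a null set if \<open>C\<close> is not zero almost
  everywhere; there the quotient is \<open>0\<close> by convention.\<close>

definition Lam :: "real \<Rightarrow> (real \<Rightarrow> complex) \<Rightarrow> real \<Rightarrow> real"
  where "Lam \<gamma> C x =
    (\<Sum>\<^sub>\<infinity>m\<in>{m::int. m \<noteq> 0}. (cmod (fourier C (x / \<gamma> + of_int m)))\<^sup>2) /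
    (\<Sum>\<^sub>\<infinity>m\<in>(UNIV::int set). (cmod (fourier C (x / \<gamma> + of_int m)))\<^sup>2)"

definition sinc_op :: "real \<Rightarrow> (real \<Rightarrow> real) \<Rightarrow> real \<Rightarrow> real"
  where "sinc_op W f t = (LINT s|lebesgue_on {-W..W}. sinc (pi * (t - s)) * f s)"

definition slepian_span :: "(nat \<Rightarrow> real \<Rightarrow> real) \<Rightarrow> nat \<Rightarrow> (real \<Rightarrow> complex) set"
  where "slepian_span \<psi> L =
    {C. \<exists>c::nat \<Rightarrow> complex. C = (\<lambda>t. \<Sum>n\<le>L. c n * complex_of_real (\<psi> n t))}"

text \<open>The basis is determined up to nonzero real factors (and null sets). Completeness, meaning
  density of the finite linear combinations, ensures that no eigenfunction is left out.\<close>

definition slepian_basis :: "real \<Rightarrow> (nat \<Rightarrow> real \<Rightarrow> real) \<Rightarrow> bool"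
  where "slepian_basis W \<psi> \<longleftrightarrow>
    (\<forall>n. (\<lambda>t. complex_of_real (\<psi> n t)) \<in> L2_I W \<and> \<not> (AE t in lebesgue. \<psi> n t = 0)) \<and>
    (\<exists>\<mu>::nat \<Rightarrow> real. strict_antimono_on UNIV \<mu> \<and>
       (\<forall>n. AE t in lebesgue_on {-W..W}. sinc_op W (\<psi> n) t = \<mu> n * \<psi> n t)) \<and>
    (\<forall>m n. m \<noteq> n \<longrightarrow> (LINT t|lebesgue. \<psi> m t * \<psi> n t) = 0) \<and>
    (\<forall>f\<in>L2_I W. \<forall>\<epsilon>>0. \<exists>N. \<exists>g\<in>slepian_span \<psi> N. Lp_norm 2 lebesgue (\<lambda>t. f t - g t) < \<epsilon>)"

definition slepian_sphere :: "(nat \<Rightarrow> real \<Rightarrow> real) \<Rightarrow> nat \<Rightarrow> (real \<Rightarrow> complex) set"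
  where "slepian_sphere \<psi> L = {C \<in> slepian_span \<psi> L. Lp_norm 2 lebesgue C = 1}"

definition pareto_optimal :: "'a measure \<Rightarrow> ('a \<Rightarrow> real) set \<Rightarrow> ('a \<Rightarrow> real) \<Rightarrow> bool"
  where "pareto_optimal M A f \<longleftrightarrow>
    f \<in> A \<and> \<not> (\<exists>g\<in>A. (AE x in M. g x \<le> f x) \<and> \<not> (AE x in M. g x = f x))"

end

theory Submission
  imports Defs
begin

text \<open>
  An element of $\Lambda(S_L)$ whose integral over $\Omega$ is least is Pareto optimal: an element
  below it almost everywhere has the same integral, hence agrees with it almost everywhere
  (\<open>pareto_optimal_if_integral_minimal\<close>). So it suffices that
  $C \mapsto \int_\Omega \Lambda C$ attains its minimum on $S_L$. By orthogonality of the
  $\psi_n$, the sphere $S_L$ is a compact ellipsoid in the coefficient space $C^{L+1}$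
  (\<open>slepian_sphere_iff\<close>), and a minimising sequence has a convergent subsequence; what is left is
  lower semicontinuity of the integral along it.

  For fixed $x$ both series in $\Lambda C(x)$ are Hermitian forms in the coefficients of $C$,
  hence continuous (\<open>tendsto_infsum_norm_square_combination\<close>); their convergence is Bessel's
  inequality for the exponentials $e^{2\pi i(y+m)t}$, which are orthogonal on an interval $[-N,N]$
  with $N$ a natural number that is at least $W$ (\<open>summable_fourier_shifts\<close>). Therefore
  $\Lambda C(x)$ is continuous in the coefficients wherever the limiting denominator is not zero.
  Where it is zero, the limiting quotient is $0$, the least possible value, so that lower
  semicontinuity persists (\<open>Lam_lower_semicontinuous\<close>). Since $0 \le \Lambda C \le 1$, lower semicontinuity
  passes to the integral by dominated convergence (\<open>integral_Lam_lower_semicontinuous\<close>).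
\<close>

section \<open>Square-integrable functions\<close>

lemma Lp_space_2_iff:
  "f \<in> Lp_space 2 M \<longleftrightarrow> f \<in> borel_measurable M \<and> integrable M (\<lambda>x. (norm (f x))\<^sup>2)"
  by (simp add: Lp_space_def)

lemma Lp_norm_2_eq_1_iff:
  "Lp_norm 2 M f = 1 \<longleftrightarrow> (LINT x|M. (norm (f x))\<^sup>2) = 1"
proof -
  have "0 \<le> (LINT x|M. (norm (f x))\<^sup>2)" by simp
  then have "(LINT x|M. (norm (f x))\<^sup>2) powr (1/2) = 1 \<longleftrightarrow> (LINT x|M. (norm (f x))\<^sup>2) = 1"
    by (simp add: powr_half_sqrt)
  then show ?thesis by (simp add: Lp_norm_def)
qed

lemma integrable_mult_cnj_L2:
  fixes f g :: "'a \<Rightarrow> complex"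
  assumes f: "f \<in> Lp_space 2 M" and g: "g \<in> Lp_space 2 M"
  shows "integrable M (\<lambda>x. f x * cnj (g x))"
proof (rule Bochner_Integration.integrable_bound)
  show "integrable M (\<lambda>x. (norm (f x))\<^sup>2 + (norm (g x))\<^sup>2)"
    using f g by (simp add: Lp_space_2_iff)
  have [measurable]: "f \<in> borel_measurable M" "g \<in> borel_measurable M"
    using f g by (auto simp: Lp_space_2_iff)
  have "(\<lambda>x. cnj (g x)) \<in> borel_measurable M"
    by (rule measurable_compose[OF _ borel_measurable_continuous_onI[OF continuous_on_cnj[OF continuous_on_id]]]) simp
  then show "(\<lambda>x. f x * cnj (g x)) \<in> borel_measurable M" by measurable
  have "a * b \<le> a\<^sup>2 + b\<^sup>2" if "a \<ge> 0" "b \<ge> 0" for a b :: real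
    using sum_squares_bound[of a b] mult_nonneg_nonneg[OF that] by linarith
  then show "AE x in M. norm (f x * cnj (g x)) \<le> norm ((norm (f x))\<^sup>2 + (norm (g x))\<^sup>2)"
    by (simp add: norm_mult)
qed

lemma norm_square_combination:
  fixes z c :: "'i \<Rightarrow> complex"
  shows "(norm (\<Sum>i\<in>I. c i * z i))\<^sup>2 = Re (\<Sum>i\<in>I. \<Sum>j\<in>I. c i * cnj (c j) * (z i * cnj (z j)))"
proof -
  have "complex_of_real ((norm (\<Sum>i\<in>I. c i * z i))\<^sup>2) =
      (\<Sum>i\<in>I. c i * z i) * cnj (\<Sum>j\<in>I. c j * z j)"
    by (simp only: complex_norm_square)
  also have "\<dots> = (\<Sum>i\<in>I. \<Sum>j\<in>I. c i * cnj (c j) * (z i * cnj (z j)))"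
    by (simp add: sum_product mult_ac)
  finally show ?thesis by (metis Re_complex_of_real)
qed

lemma sum_in_L2:
  fixes f :: "'i \<Rightarrow> 'a \<Rightarrow> complex"
  assumes "finite I" and f: "\<And>i. i \<in> I \<Longrightarrow> f i \<in> Lp_space 2 M"
  shows "(\<lambda>x. \<Sum>i\<in>I. c i * f i x) \<in> Lp_space 2 M"
proof -
  have meas: "(\<lambda>x. \<Sum>i\<in>I. c i * f i x) \<in> borel_measurable M"
    using f by (intro borel_measurable_sum borel_measurable_times) (auto simp: Lp_space_2_iff)
  have "integrable M (\<lambda>x. Re (\<Sum>i\<in>I. \<Sum>j\<in>I. (c i * cnj (c j)) * (f i x * cnj (f j x))))"
    using f by (intro integrable_Re Bochner_Integration.integrable_sum integrable_mult_right
        integrable_mult_cnj_L2) auto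
  then have "integrable M (\<lambda>x. (norm (\<Sum>i\<in>I. c i * f i x))\<^sup>2)"
    by (simp only: norm_square_combination)
  then show ?thesis using meas by (simp add: Lp_space_2_iff)
qed

lemma integral_norm_square_sum:
  fixes f :: "'i \<Rightarrow> 'a \<Rightarrow> complex"
  assumes "finite I" and f: "\<And>i. i \<in> I \<Longrightarrow> f i \<in> Lp_space 2 M"
  shows "complex_of_real (LINT x|M. (norm (\<Sum>i\<in>I. c i * f i x))\<^sup>2) =
    (\<Sum>i\<in>I. \<Sum>j\<in>I. c i * cnj (c j) * (LINT x|M. f i x * cnj (f j x)))"
proof -
  have "complex_of_real (LINT x|M. (norm (\<Sum>i\<in>I. c i * f i x))\<^sup>2) =
      (LINT x|M. (\<Sum>i\<in>I. \<Sum>j\<in>I. (c i * cnj (c j)) * (f i x * cnj (f j x))))"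
    unfolding integral_complex_of_real[symmetric] complex_norm_square
    by (simp add: sum_product mult_ac)
  also have "\<dots> = (\<Sum>i\<in>I. \<Sum>j\<in>I. c i * cnj (c j) * (LINT x|M. f i x * cnj (f j x)))"
    using f by (simp add: Bochner_Integration.integral_sum integrable_mult_cnj_L2)
  finally show ?thesis .
qed

text \<open>The inequality says that subtracting $\sum_i z_i e_i / K$, with
  $z_i = \int f \overline{e_i}$, leaves a function whose square norm is not negative.\<close>

lemma Bessel_inequality:
  fixes f :: "'a \<Rightarrow> complex" and e :: "'i \<Rightarrow> 'a \<Rightarrow> complex"
  assumes F: "finite F" and f: "f \<in> Lp_space 2 M" and e: "\<And>i. i \<in> F \<Longrightarrow> e i \<in> Lp_space 2 M"
    and K: "K > 0"
    and orth: "\<And>i j. i \<in> F \<Longrightarrow> j \<in> F \<Longrightarrow>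
      (LINT x|M. e i x * cnj (e j x)) = (if i = j then complex_of_real K else 0)"
  shows "(\<Sum>i\<in>F. (norm (LINT x|M. f x * cnj (e i x)))\<^sup>2) \<le> K * (LINT x|M. (norm (f x))\<^sup>2)"
proof -
  define z where "z i = (LINT x|M. f x * cnj (e i x))" for i
  define S where "S = (\<Sum>i\<in>F. (norm (z i))\<^sup>2)"
  define g where "g x = (\<Sum>i\<in>F. z i * e i x)" for x
  have g: "g \<in> Lp_space 2 M" unfolding g_def by (rule sum_in_L2[OF F e])
  have "complex_of_real (LINT x|M. (norm (g x))\<^sup>2) = (\<Sum>i\<in>F. z i * cnj (z i) * K)"
    unfolding g_def using F
    by (simp add: integral_norm_square_sum[OF F e] orth if_distrib cong: if_cong sum.cong)
  also have "\<dots> = complex_of_real (K * S)"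
    by (simp add: S_def complex_norm_square sum_distrib_left mult_ac del: of_real_power)
  finally have gg: "(LINT x|M. (norm (g x))\<^sup>2) = K * S" using of_real_eq_iff by blast
  have "(LINT x|M. f x * cnj (g x)) = (LINT x|M. (\<Sum>i\<in>F. cnj (z i) * (f x * cnj (e i x))))"
    by (simp add: g_def sum_distrib_left mult_ac)
  also have "\<dots> = (\<Sum>i\<in>F. cnj (z i) * z i)"
    using f e by (subst Bochner_Integration.integral_sum) (simp_all add: integrable_mult_cnj_L2 z_def)
  also have "\<dots> = complex_of_real S"
    by (simp add: S_def complex_norm_square mult.commute del: of_real_power)
  finally have fg: "(LINT x|M. f x * cnj (g x)) = complex_of_real S" .
  have pointwise: "0 \<le> (norm a)\<^sup>2 - 2 / K * Re (a * cnj b) + (norm b)\<^sup>2 / K\<^sup>2" for a b :: complex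
  proof -
    have "(norm (a - b / K))\<^sup>2 = (Re a - Re b / K)\<^sup>2 + (Im a - Im b / K)\<^sup>2"
      by (simp add: cmod_power2)
    also have "\<dots> = (norm a)\<^sup>2 - 2 / K * Re (a * cnj b) + (norm b)\<^sup>2 / K\<^sup>2"
      unfolding cmod_power2 by (simp add: power2_eq_square algebra_simps add_divide_distrib)
    finally have "(norm (a - b / K))\<^sup>2 = (norm a)\<^sup>2 - 2 / K * Re (a * cnj b) + (norm b)\<^sup>2 / K\<^sup>2" .
    then show ?thesis by (metis zero_le_power2)
  qed
  have int: "integrable M (\<lambda>x. (norm (f x))\<^sup>2)" "integrable M (\<lambda>x. (norm (g x))\<^sup>2)"
    "integrable M (\<lambda>x. f x * cnj (g x))"
    using f g integrable_mult_cnj_L2[OF f g] by (auto simp: Lp_space_2_iff)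
  have "0 \<le> (LINT x|M. (norm (f x))\<^sup>2 - 2 / K * Re (f x * cnj (g x)) + (norm (g x))\<^sup>2 / K\<^sup>2)"
    by (intro integral_nonneg_AE AE_I2 pointwise)
  also have "\<dots> = (LINT x|M. (norm (f x))\<^sup>2) - 2 / K * Re (LINT x|M. f x * cnj (g x))
      + (LINT x|M. (norm (g x))\<^sup>2) / K\<^sup>2"
    using int integrable_Re[OF int(3)] integral_Re[OF int(3)]
    by (simp del: times_complex.sel)
  also have "\<dots> = (LINT x|M. (norm (f x))\<^sup>2) - S / K"
    unfolding gg fg using K by (simp add: field_simps power2_eq_square)
  finally show ?thesis using K by (simp add: S_def z_def field_simps)
qed

section \<open>Fourier transforms of functions on an interval\<close>

lemma integral_exp_period:
  fixes N :: nat and k :: int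
  assumes "k \<noteq> 0"
  shows "(LINT t|lebesgue_on {- real N..real N}. exp (2 * complex_of_real pi * \<i> * k * complex_of_real t)) = 0"
proof -
  define w where "w = 2 * complex_of_real pi * \<i> * of_int k"
  have w: "w \<noteq> 0" using assms by (simp add: w_def)
  have "((\<lambda>t. exp (w * complex_of_real t)) has_integral
      exp (w * complex_of_real (real N)) / w - exp (w * complex_of_real (- real N)) / w) {- real N..real N}"
    using w by (intro fundamental_theorem_of_calculus)
      (auto intro!: derivative_eq_intros has_vector_derivative_real_field simp: mult_ac)
  moreover have "exp (w * complex_of_real (real N)) = exp (w * complex_of_real (- real N))"
    unfolding exp_eq by (intro exI[of _ "2 * k * int N"]) (simp add: w_def algebra_simps)
  ultimately have "integral {- real N..real N} (\<lambda>t. exp (w * complex_of_real t)) = 0"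
    by (simp add: integral_unique)
  moreover have "integrable (lebesgue_on {- real N..real N}) (\<lambda>t. exp (w * complex_of_real t))"
    by (intro continuous_imp_integrable_real continuous_intros)
  ultimately show ?thesis
    by (simp add: lebesgue_integral_eq_integral w_def)
qed

lemma fourier_eq_lebesgue_on:
  assumes "W \<le> a" and "C \<in> L2_I W"
  shows "fourier C x = (LINT t|lebesgue_on {-a..a}. C t *
    cnj (exp (2 * complex_of_real pi * \<i> * complex_of_real x * complex_of_real t)))"
proof -
  have z: "C t = 0" if "t \<notin> {-a..a}" for t using assms that by (auto simp: L2_I_def)
  have "fourier C x = (LINT t|lebesgue. (if t \<in> {-a..a} then C t *
      cnj (exp (2 * complex_of_real pi * \<i> * complex_of_real x * complex_of_real t)) else 0))"
    unfolding fourier_def using z by (intro Bochner_Integration.integral_cong) (auto simp: exp_cnj)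
  then show ?thesis by (subst (asm) Lebesgue_Measure.integral_restrict_UNIV) auto
qed

text \<open>On $[-N,N]$ the exponentials with frequencies $y+m$ have integer frequency differences and
  full periods, so they are orthogonal with square norm $2N$. The numbers $\widehat{C}(y+m)$ are the
  inner products of $C$ with them, and Bessel's inequality bounds all partial sums by
  $2N\,\|C\|_2^2$.\<close>

lemma summable_fourier_shifts:
  assumes C: "C \<in> L2_I W"
  shows "(\<lambda>m::int. (cmod (fourier C (y + of_int m)))\<^sup>2) summable_on UNIV"
proof -
  obtain N :: nat where N: "max 1 W \<le> real N" using real_arch_simple by blast
  define M where "M = lebesgue_on {- real N..real N}"
  define e where "e m t = exp (2 * complex_of_real pi * \<i> * complex_of_real (y + of_int m) * complex_of_real t)"
    for m :: int and t
  have fin: "finite_measure M"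
    unfolding M_def by (intro finite_measure_lebesgue_on) auto
  have CM: "C \<in> Lp_space 2 M"
    using C unfolding M_def L2_I_def Lp_space_2_iff
    by (auto intro!: measurable_restrict_space1 integrable_restrict_space[THEN iffD2] integrable_mult_indicator)
  have ne: "norm (e m t) = 1" for m t by (simp add: e_def)
  have eM: "e m \<in> Lp_space 2 M" for m
  proof -
    have "integrable M (e m)" unfolding M_def e_def
      by (intro continuous_imp_integrable_real continuous_intros)
    then show ?thesis using fin by (auto simp: Lp_space_2_iff ne finite_measure.integrable_const)
  qed
  have orth: "(LINT t|M. e i t * cnj (e j t)) = (if i = j then complex_of_real (2 * real N) else 0)" for i j
  proof -
    have "e i t * cnj (e j t) = exp (2 * complex_of_real pi * \<i> * of_int (i - j) * complex_of_real t)" for t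
      unfolding e_def exp_cnj exp_add[symmetric] by (simp add: algebra_simps)
    then show ?thesis using integral_exp_period[of "i - j" N]
      by (auto simp: M_def measure_restrict_space scaleR_conv_of_real)
  qed
  show ?thesis
  proof (rule nonneg_bdd_above_summable_on)
    have "(\<Sum>m\<in>F. (cmod (fourier C (y + of_int m)))\<^sup>2) \<le> 2 * real N * (LINT t|M. (norm (C t))\<^sup>2)"
      if "finite F" for F
    proof -
      have "fourier C (y + of_int m) = (LINT t|M. C t * cnj (e m t))" for m
        unfolding M_def e_def using N C by (intro fourier_eq_lebesgue_on) auto
      then show ?thesis
        using Bessel_inequality[OF that CM eM _ orth] N by simp
    qed
    then show "bdd_above (sum (\<lambda>m. (cmod (fourier C (y + of_int m)))\<^sup>2) ` {F. F \<subseteq> UNIV \<and> finite F})"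
      by (auto simp: bdd_above_def)
  qed simp
qed

text \<open>On the bounded interval, $|C| \le 1 + |C|^2$.\<close>

lemma L2_I_integrable:
  assumes C: "C \<in> L2_I W"
  shows "integrable lebesgue C"
proof (rule Bochner_Integration.integrable_bound)
  have "integrable lebesgue (indicat_real {-W..W})"
    by (intro integrable_real_indicator) (auto simp: emeasure_lborel_Icc_eq)
  then show "integrable lebesgue (\<lambda>t. indicat_real {-W..W} t + (norm (C t))\<^sup>2)"
    using C by (auto simp: L2_I_def Lp_space_2_iff)
  show "C \<in> borel_measurable lebesgue" using C by (auto simp: L2_I_def Lp_space_2_iff)
  have "norm (C t) \<le> indicat_real {-W..W} t + (norm (C t))\<^sup>2" for t
  proof (cases "t \<in> {-W..W}")
    case True
    have "0 \<le> (norm (C t) - 1)\<^sup>2" by simp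
    then have "2 * norm (C t) \<le> 1 + (norm (C t))\<^sup>2" unfolding power2_diff by simp
    then show ?thesis using True zero_le_power2[of "norm (C t)"] by (smt (verit) indicator_simps(1))
  qed (use C in \<open>auto simp: L2_I_def\<close>)
  then show "AE t in lebesgue. norm (C t) \<le> norm (indicat_real {-W..W} t + (norm (C t))\<^sup>2)"
    by (simp add: order_trans[OF _ abs_ge_self])
qed

lemma continuous_on_fourier:
  assumes C: "integrable lebesgue C"
  shows "continuous_on UNIV (fourier C)"
proof -
  have "(\<lambda>k. fourier C (u k)) \<longlonglongrightarrow> fourier C x" if "u \<longlonglongrightarrow> x" for u :: "nat \<Rightarrow> real" and x
    unfolding fourier_def
  proof (rule integral_dominated_convergence)
    have [measurable]: "C \<in> borel_measurable lebesgue" using C by auto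
    have cont: "(\<lambda>t. exp (- (2 * complex_of_real pi * \<i> * complex_of_real y * complex_of_real t)))
        \<in> borel_measurable lebesgue" for y
      by (intro measurable_completion) (auto intro!: borel_measurable_continuous_onI continuous_intros)
    show "(\<lambda>t. C t * exp (- (2 * complex_of_real pi * \<i> * complex_of_real y * complex_of_real t)))
        \<in> borel_measurable lebesgue" for y
      using cont by measurable
    then show "(\<lambda>t. C t * exp (- (2 * complex_of_real pi * \<i> * complex_of_real (u k) * complex_of_real t)))
        \<in> borel_measurable lebesgue" for k .
    show "integrable lebesgue (\<lambda>t. norm (C t))" using C by simp
    show "AE t in lebesgue. (\<lambda>k. C t * exp (- (2 * complex_of_real pi * \<i> * complex_of_real (u k) * complex_of_real t)))
       \<longlonglongrightarrow> C t * exp (- (2 * complex_of_real pi * \<i> * complex_of_real x * complex_of_real t))"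
      by (intro AE_I2 tendsto_intros that)
    show "AE t in lebesgue. norm (C t * exp (- (2 * complex_of_real pi * \<i> * complex_of_real (u k) * complex_of_real t)))
        \<le> norm (C t)" for k
      by (simp add: norm_mult)
  qed
  then show ?thesis by (auto simp: continuous_on_sequentially o_def)
qed

lemma fourier_sum:
  assumes "\<And>i. i \<in> I \<Longrightarrow> integrable lebesgue (f i)"
  shows "fourier (\<lambda>t. \<Sum>i\<in>I. c i * f i t) x = (\<Sum>i\<in>I. c i * fourier (f i) x)"
proof -
  let ?e = "\<lambda>t. exp (- (2 * complex_of_real pi * \<i> * complex_of_real x * complex_of_real t))"
  have "integrable lebesgue (\<lambda>t. f i t * ?e t)" if "i \<in> I" for i
  proof (rule Bochner_Integration.integrable_bound)
    show "integrable lebesgue (f i)" by (rule assms[OF that])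
    then have [measurable]: "f i \<in> borel_measurable lebesgue" by auto
    have [measurable]: "?e \<in> borel_measurable lebesgue"
      by (intro measurable_completion) (auto intro!: borel_measurable_continuous_onI continuous_intros)
    show "(\<lambda>t. f i t * ?e t) \<in> borel_measurable lebesgue" by measurable
  qed (simp add: norm_mult)
  then show ?thesis
    unfolding fourier_def sum_distrib_right mult.assoc
    by (subst Bochner_Integration.integral_sum) auto
qed

section \<open>Continuity of the quotient in the coefficients\<close>

lemma has_sum_finite_sum:
  fixes f :: "'i \<Rightarrow> 'a \<Rightarrow> 'b::topological_comm_monoid_add"
  assumes "\<And>i. i \<in> I \<Longrightarrow> (f i has_sum s i) A"
  shows "((\<lambda>m. \<Sum>i\<in>I. f i m) has_sum (\<Sum>i\<in>I. s i)) A"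
  using assms by (induction I rule: infinite_finite_induct) (auto intro: has_sum_add)

text \<open>Expanding the square turns the series into a Hermitian form in \<open>c\<close> whose Gram matrix does not
  depend on \<open>c\<close>; its entries converge absolutely by the Cauchy-Schwarz inequality. With only
  finitely many coefficients, continuity in \<open>c\<close> is then immediate.\<close>

lemma has_sum_norm_square_combination:
  fixes h :: "'i \<Rightarrow> 'a \<Rightarrow> complex"
  assumes "finite I" and h: "\<And>i. i \<in> I \<Longrightarrow> (\<lambda>m. (cmod (h i m))\<^sup>2) summable_on A"
  shows "((\<lambda>m. (cmod (\<Sum>i\<in>I. c i * h i m))\<^sup>2) has_sum
    Re (\<Sum>i\<in>I. \<Sum>j\<in>I. c i * cnj (c j) * (\<Sum>\<^sub>\<infinity>m\<in>A. h i m * cnj (h j m)))) A"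
proof -
  have "((\<lambda>m. h i m * cnj (h j m)) has_sum (\<Sum>\<^sub>\<infinity>m\<in>A. h i m * cnj (h j m))) A"
    if "i \<in> I" "j \<in> I" for i j
  proof -
    have "(\<lambda>m. norm (h i m * cnj (h j m))) summable_on A"
      by (rule abs_summable_product)
        (use h[OF that(1)] h[OF that(2)] in \<open>simp_all add: norm_mult power2_eq_square\<close>)
    then show ?thesis by (rule has_sum_infsum[OF abs_summable_summable])
  qed
  then have "((\<lambda>m. \<Sum>i\<in>I. \<Sum>j\<in>I. c i * cnj (c j) * (h i m * cnj (h j m))) has_sum
      (\<Sum>i\<in>I. \<Sum>j\<in>I. c i * cnj (c j) * (\<Sum>\<^sub>\<infinity>m\<in>A. h i m * cnj (h j m)))) A"
    by (rule has_sum_finite_sum[OF has_sum_finite_sum[OF has_sum_cmult_right]])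
  then have "((\<lambda>m. Re (\<Sum>i\<in>I. \<Sum>j\<in>I. c i * cnj (c j) * (h i m * cnj (h j m)))) has_sum
      Re (\<Sum>i\<in>I. \<Sum>j\<in>I. c i * cnj (c j) * (\<Sum>\<^sub>\<infinity>m\<in>A. h i m * cnj (h j m)))) A"
    by (rule has_sum_Re)
  then show ?thesis by (simp only: norm_square_combination)
qed

lemma tendsto_infsum_norm_square_combination:
  fixes h :: "'i \<Rightarrow> 'a \<Rightarrow> complex"
  assumes "finite I" and h: "\<And>i. i \<in> I \<Longrightarrow> (\<lambda>m. (cmod (h i m))\<^sup>2) summable_on A"
    and c: "\<And>i. i \<in> I \<Longrightarrow> ((\<lambda>k. c k i) \<longlongrightarrow> d i) F"
  shows "((\<lambda>k. \<Sum>\<^sub>\<infinity>m\<in>A. (cmod (\<Sum>i\<in>I. c k i * h i m))\<^sup>2) \<longlongrightarrow>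
    (\<Sum>\<^sub>\<infinity>m\<in>A. (cmod (\<Sum>i\<in>I. d i * h i m))\<^sup>2)) F"
  using c by (simp only: infsumI[OF has_sum_norm_square_combination[OF assms(1) h]])
    (intro tendsto_intros)

lemma Lam_bounds:
  assumes "C \<in> L2_I W"
  shows "0 \<le> Lam \<gamma> C x" "Lam \<gamma> C x \<le> 1"
proof -
  note S = summable_fourier_shifts[OF assms, of "x / \<gamma>"]
  have "0 \<le> (\<Sum>\<^sub>\<infinity>m\<in>{m::int. m \<noteq> 0}. (cmod (fourier C (x / \<gamma> + of_int m)))\<^sup>2)"
    by (rule infsum_nonneg) simp
  moreover have "(\<Sum>\<^sub>\<infinity>m\<in>{m::int. m \<noteq> 0}. (cmod (fourier C (x / \<gamma> + of_int m)))\<^sup>2) \<le>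
      (\<Sum>\<^sub>\<infinity>m\<in>(UNIV::int set). (cmod (fourier C (x / \<gamma> + of_int m)))\<^sup>2)"
    by (intro infsum_mono2 S summable_on_subset_banach[OF S]) auto
  ultimately show "0 \<le> Lam \<gamma> C x" "Lam \<gamma> C x \<le> 1"
    by (auto simp: Lam_def divide_le_eq_1)
qed

text \<open>The series over the integers is rewritten as one over the naturals, and the numerator as
  the denominator minus the term for $m = 0$, to reduce to measurability of \<open>suminf\<close>.\<close>

lemma Lam_measurable:
  assumes C: "C \<in> L2_I W"
  shows "Lam \<gamma> C \<in> borel_measurable borel"
proof -
  define q where "q y = (cmod (fourier C y))\<^sup>2" for y
  define D where "D x = (\<Sum>k. q (x / \<gamma> + of_int (int_decode k)))" for x
  have [measurable]: "fourier C \<in> borel_measurable borel"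
    by (intro borel_measurable_continuous_onI continuous_on_fourier L2_I_integrable[OF C])
  have [measurable]: "q \<in> borel_measurable borel" unfolding q_def by measurable
  have [measurable]: "D \<in> borel_measurable borel" unfolding D_def by measurable
  have "Lam \<gamma> C x = (D x - q (x / \<gamma>)) / D x" for x
  proof -
    let ?q = "\<lambda>m::int. q (x / \<gamma> + of_int m)"
    have S: "?q summable_on A" for A
      using summable_fourier_shifts[OF C, of "x / \<gamma>"] unfolding q_def
      by (rule summable_on_subset_banach) simp
    have "(?q has_sum infsum ?q UNIV) UNIV" using S by simp
    then have "((\<lambda>k. ?q (int_decode k)) has_sum infsum ?q UNIV) UNIV"
      by (subst has_sum_reindex_bij_betw[OF bij_int_decode, of ?q])
    then have D: "infsum ?q UNIV = D x" unfolding D_def by (rule sums_unique[OF has_sum_imp_sums])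
    have "infsum ?q UNIV = infsum ?q {0} + infsum ?q {m. m \<noteq> 0}"
      using S by (subst infsum_Un_disjoint[symmetric]) (auto intro!: arg_cong[where f = "infsum _"])
    then show ?thesis unfolding D[symmetric] by (simp add: Lam_def q_def)
  qed
  then have "Lam \<gamma> C = (\<lambda>x. (D x - q (x / \<gamma>)) / D x)" by (rule ext)
  also have "\<dots> \<in> borel_measurable borel" by measurable
  finally show ?thesis .
qed

lemma Lam_integrable:
  assumes C: "C \<in> L2_I W"
  shows "integrable Omega (Lam \<gamma> C)"
proof -
  have fin: "finite_measure Omega"
    by (intro finite_measure_lebesgue_on bounded_set_imp_lmeasurable) auto
  have "Lam \<gamma> C \<in> borel_measurable Omega"
    using Lam_measurable[OF C] by (simp add: measurable_completion measurable_restrict_space1)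
  then show ?thesis
    using Lam_bounds[OF C] by (intro finite_measure.integrable_const_bound[OF fin, of _ 1]) auto
qed

lemma Lam_in_Lp_space:
  assumes C: "C \<in> L2_I W" and "p \<ge> 0"
  shows "Lam \<gamma> C \<in> Lp_space p Omega"
proof -
  have fin: "finite_measure Omega"
    by (intro finite_measure_lebesgue_on bounded_set_imp_lmeasurable) auto
  have meas [measurable]: "Lam \<gamma> C \<in> borel_measurable Omega" using Lam_integrable[OF C] by auto
  have "(\<lambda>x. Lam \<gamma> C x powr p) \<in> borel_measurable Omega" by measurable
  then have "integrable Omega (\<lambda>x. norm (Lam \<gamma> C x) powr p)"
    using Lam_bounds[OF C] \<open>p \<ge> 0\<close>
    by (intro finite_measure.integrable_const_bound[OF fin, of _ 1]) (auto simp: powr_le1)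
  with meas show ?thesis unfolding Lp_space_def by blast
qed

lemma sum_in_L2_I:
  assumes "finite I" and "\<And>i. i \<in> I \<Longrightarrow> \<phi> i \<in> L2_I W"
  shows "(\<lambda>t. \<Sum>i\<in>I. c i * \<phi> i t) \<in> L2_I W"
  using assms sum_in_L2[of I \<phi> lebesgue c] by (auto simp: L2_I_def intro!: sum.neutral)

text \<open>Taking the minimum with the limit value states lower semicontinuity as a genuine limit, in
  the form that dominated convergence needs.\<close>

lemma Lam_lower_semicontinuous:
  assumes I: "finite I" and \<phi>: "\<And>i. i \<in> I \<Longrightarrow> \<phi> i \<in> L2_I W"
    and c: "\<And>i. i \<in> I \<Longrightarrow> ((\<lambda>k. c k i) \<longlongrightarrow> d i) F"
  shows "((\<lambda>k. min (Lam \<gamma> (\<lambda>t. \<Sum>i\<in>I. c k i * \<phi> i t) x) (Lam \<gamma> (\<lambda>t. \<Sum>i\<in>I. d i * \<phi> i t) x))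
    \<longlongrightarrow> Lam \<gamma> (\<lambda>t. \<Sum>i\<in>I. d i * \<phi> i t) x) F"
    (is "((\<lambda>k. min (Lam \<gamma> (?C k) x) (Lam \<gamma> ?D x)) \<longlongrightarrow> _) F")
proof -
  define S where "S A C = (\<Sum>\<^sub>\<infinity>m\<in>A. (cmod (fourier C (x / \<gamma> + of_int m)))\<^sup>2)" for A :: "int set" and C
  have Lam: "Lam \<gamma> C x = S {m. m \<noteq> 0} C / S UNIV C" for C by (simp add: Lam_def S_def)
  have lim: "((\<lambda>k. S A (?C k)) \<longlongrightarrow> S A ?D) F" for A
  proof -
    have four: "fourier (\<lambda>t. \<Sum>i\<in>I. b i * \<phi> i t) y = (\<Sum>i\<in>I. b i * fourier (\<phi> i) y)" for b y
      using \<phi> by (intro fourier_sum L2_I_integrable)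
    show ?thesis
      unfolding S_def four using I \<phi> c
      by (intro tendsto_infsum_norm_square_combination summable_on_subset_banach[OF summable_fourier_shifts]) auto
  qed
  show ?thesis
  proof (cases "S UNIV ?D = 0")
    case True
    \<comment> \<open>Division by zero yields \<open>0\<close>, a lower bound of all values of the quotient.\<close>
    then have "Lam \<gamma> ?D x = 0" by (simp add: Lam)
    moreover have "0 \<le> Lam \<gamma> (?C k) x" for k by (rule Lam_bounds[OF sum_in_L2_I[OF I \<phi>]])
    ultimately show ?thesis by simp
  next
    case False
    then have "((\<lambda>k. Lam \<gamma> (?C k) x) \<longlongrightarrow> Lam \<gamma> ?D x) F"
      unfolding Lam by (intro tendsto_divide lim)
    from tendsto_min[OF this tendsto_const[of "Lam \<gamma> ?D x"]] show ?thesis by simp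
  qed
qed

lemma integral_Lam_lower_semicontinuous:
  fixes c :: "nat \<Rightarrow> 'i \<Rightarrow> complex"
  assumes I: "finite I" and \<phi>: "\<And>i. i \<in> I \<Longrightarrow> \<phi> i \<in> L2_I W"
    and c: "\<And>i. i \<in> I \<Longrightarrow> (\<lambda>k. c k i) \<longlonglongrightarrow> d i"
    and lim: "(\<lambda>k. LINT x|Omega. Lam \<gamma> (\<lambda>t. \<Sum>i\<in>I. c k i * \<phi> i t) x) \<longlonglongrightarrow> J"
  shows "(LINT x|Omega. Lam \<gamma> (\<lambda>t. \<Sum>i\<in>I. d i * \<phi> i t) x) \<le> J"
proof -
  let ?C = "\<lambda>b t. \<Sum>i\<in>I. b i * \<phi> i t"
  note C = sum_in_L2_I[OF I \<phi>]
  have int: "integrable Omega (Lam \<gamma> (?C b))" for b by (rule Lam_integrable[OF C])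
  have int_min: "integrable Omega (\<lambda>x. min (Lam \<gamma> (?C (c k)) x) (Lam \<gamma> (?C d) x))" for k
    by (intro integrable_min int)
  have "(\<lambda>k. LINT x|Omega. min (Lam \<gamma> (?C (c k)) x) (Lam \<gamma> (?C d) x)) \<longlonglongrightarrow>
      (LINT x|Omega. Lam \<gamma> (?C d) x)"
  proof (rule integral_dominated_convergence[where w = "Lam \<gamma> (?C d)"])
    show "AE x in Omega. (\<lambda>k. min (Lam \<gamma> (?C (c k)) x) (Lam \<gamma> (?C d) x)) \<longlonglongrightarrow> Lam \<gamma> (?C d) x"
      by (intro AE_I2 Lam_lower_semicontinuous[OF I \<phi> c])
    show "AE x in Omega. norm (min (Lam \<gamma> (?C (c k)) x) (Lam \<gamma> (?C d) x)) \<le> Lam \<gamma> (?C d) x" for k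
      using Lam_bounds(1)[OF C] by (intro AE_I2) (simp add: min_def)
    show "(\<lambda>x. min (Lam \<gamma> (?C (c k)) x) (Lam \<gamma> (?C d) x)) \<in> borel_measurable Omega" for k
      using int_min by (rule borel_measurable_integrable)
  qed (use int in auto)
  then show ?thesis
    by (rule LIMSEQ_le[OF _ lim]) (intro exI allI impI integral_mono int int_min, simp)
qed

section \<open>Pareto optimality by minimisation\<close>

lemma pareto_optimal_if_integral_minimal:
  assumes "f \<in> A" and int: "\<And>g. g \<in> A \<Longrightarrow> integrable M g"
    and min: "\<And>g. g \<in> A \<Longrightarrow> (LINT x|M. f x) \<le> (LINT x|M. g x)"
  shows "pareto_optimal M A f"
proof -
  have "AE x in M. g x = f x" if g: "g \<in> A" and le: "AE x in M. g x \<le> f x" for g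
  proof -
    have int': "integrable M (\<lambda>x. f x - g x)" using int \<open>f \<in> A\<close> g by simp
    have nonneg: "AE x in M. 0 \<le> f x - g x" using le by simp
    have "(LINT x|M. f x - g x) = (LINT x|M. f x) - (LINT x|M. g x)"
      using int \<open>f \<in> A\<close> g by (intro Bochner_Integration.integral_diff)
    also have "\<dots> \<le> 0" using min[OF g] by simp
    finally have "(LINT x|M. f x - g x) = 0" using integral_nonneg_AE[OF nonneg] by linarith
    then have "AE x in M. f x - g x = 0" using integral_nonneg_eq_0_iff_AE[OF int' nonneg] by simp
    then show ?thesis by (auto elim: AE_mp)
  qed
  then show ?thesis using \<open>f \<in> A\<close> by (auto simp: pareto_optimal_def)
qed

lemma coordinatewise_convergent_subsequence:
  fixes c :: "nat \<Rightarrow> 'i \<Rightarrow> 'a::heine_borel"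
  assumes "finite I" and "\<And>i. i \<in> I \<Longrightarrow> bounded (range (\<lambda>k. c k i))"
  shows "\<exists>r d. strict_mono (r :: nat \<Rightarrow> nat) \<and> (\<forall>i\<in>I. (\<lambda>k. c (r k) i) \<longlonglongrightarrow> d i)"
  using assms
proof (induction I rule: finite_induct)
  case empty
  show ?case by (auto intro: exI[of _ id] simp: strict_mono_id)
next
  case (insert j I)
  then obtain r d where r: "strict_mono (r :: nat \<Rightarrow> nat)" "\<forall>i\<in>I. (\<lambda>k. c (r k) i) \<longlonglongrightarrow> d i" by auto
  have "bounded (range (\<lambda>k. c (r k) j))"
    using insert.prems[of j] by (rule bounded_subset) auto
  then obtain s l where s: "strict_mono (s :: nat \<Rightarrow> nat)" "((\<lambda>k. c (r k) j) \<circ> s) \<longlonglongrightarrow> l"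
    using bounded_imp_convergent_subsequence by blast
  have "(\<lambda>k. c (r (s k)) i) \<longlonglongrightarrow> (d(j := l)) i" if "i \<in> insert j I" for i
    using that s(2) LIMSEQ_subseq_LIMSEQ[OF r(2)[rule_format, of i] s(1)] by (auto simp: o_def)
  then show ?case
    using strict_mono_o[OF r(1) s(1)] by (intro exI[of _ "r \<circ> s"] exI[of _ "d(j := l)"]) (simp add: o_def)
qed

lemma slepian_norm_square:
  assumes "slepian_basis W \<psi>"
  shows "(LINT t|lebesgue. (norm (\<Sum>n\<le>L. c n * complex_of_real (\<psi> n t)))\<^sup>2) =
    (\<Sum>n\<le>L. (norm (c n))\<^sup>2 * (LINT t|lebesgue. (\<psi> n t)\<^sup>2))" (is "?l = ?r")
proof -
  have L2: "(\<lambda>t. complex_of_real (\<psi> n t)) \<in> Lp_space 2 lebesgue" for n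
    using assms by (auto simp: slepian_basis_def L2_I_def)
  have orth: "(LINT t|lebesgue. complex_of_real (\<psi> m t) * complex_of_real (\<psi> n t)) =
      (if m = n then complex_of_real (LINT t|lebesgue. (\<psi> n t)\<^sup>2) else 0)" for m n
  proof -
    have "(LINT t|lebesgue. complex_of_real (\<psi> m t) * complex_of_real (\<psi> n t)) =
        complex_of_real (LINT t|lebesgue. \<psi> m t * \<psi> n t)"
      unfolding integral_complex_of_real[symmetric] by simp
    then show ?thesis using assms by (auto simp: slepian_basis_def power2_eq_square)
  qed
  have "complex_of_real ?l = complex_of_real ?r"
    by (simp add: orth integral_norm_square_sum[OF _ L2] complex_norm_square if_distrib
        del: of_real_power cong: if_cong)
  then show ?thesis using of_real_eq_iff by blast
qed

lemma slepian_norm_pos: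
  assumes "slepian_basis W \<psi>"
  shows "0 < (LINT t|lebesgue. (\<psi> n t)\<^sup>2)"
proof -
  have "(\<lambda>t. complex_of_real (\<psi> n t)) \<in> Lp_space 2 lebesgue" and nz: "\<not> (AE t in lebesgue. \<psi> n t = 0)"
    using assms by (auto simp: slepian_basis_def L2_I_def)
  then have "integrable lebesgue (\<lambda>t. (\<psi> n t)\<^sup>2)" by (simp add: Lp_space_2_iff)
  then have "(LINT t|lebesgue. (\<psi> n t)\<^sup>2) \<noteq> 0"
    using nz by (subst integral_nonneg_eq_0_iff_AE) auto
  moreover have "0 \<le> (LINT t|lebesgue. (\<psi> n t)\<^sup>2)" by simp
  ultimately show ?thesis by linarith
qed

lemma slepian_sphere_iff:
  assumes "slepian_basis W \<psi>"
  shows "C \<in> slepian_sphere \<psi> L \<longleftrightarrow>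
    (\<exists>c. C = (\<lambda>t. \<Sum>n\<le>L. c n * complex_of_real (\<psi> n t)) \<and>
      (\<Sum>n\<le>L. (norm (c n))\<^sup>2 * (LINT t|lebesgue. (\<psi> n t)\<^sup>2)) = 1)"
  using slepian_norm_square[OF assms]
  by (auto simp: slepian_sphere_def slepian_span_def Lp_norm_2_eq_1_iff)

text \<open>The direct method: on the sphere, $|c_n|^2 a_n \le 1$ with $a_n = \|\psi_n\|_2^2 > 0$ bounds
  the coefficients of a minimising sequence, and the norm condition survives in the limit.\<close>

lemma exists_Lam_integral_minimiser:
  assumes \<psi>: "slepian_basis W \<psi>"
  shows "\<exists>C\<in>slepian_sphere \<psi> L. \<forall>B\<in>slepian_sphere \<psi> L.
    (LINT x|Omega. Lam \<gamma> C x) \<le> (LINT x|Omega. Lam \<gamma> B x)"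
proof -
  define J where "J C = (LINT x|Omega. Lam \<gamma> C x)" for C
  define a where "a n = (LINT t|lebesgue. (\<psi> n t)\<^sup>2)" for n
  define comb where "comb c = (\<lambda>t. \<Sum>n\<le>L. c n * complex_of_real (\<psi> n t))" for c
  have a: "a n > 0" for n unfolding a_def by (rule slepian_norm_pos[OF \<psi>])
  have sphere: "C \<in> slepian_sphere \<psi> L \<longleftrightarrow> (\<exists>c. C = comb c \<and> (\<Sum>n\<le>L. (norm (c n))\<^sup>2 * a n) = 1)" for C
    unfolding comb_def a_def by (rule slepian_sphere_iff[OF \<psi>])
  have L2: "(\<lambda>t. complex_of_real (\<psi> n t)) \<in> L2_I W" for n
    using \<psi> by (auto simp: slepian_basis_def)
  have comb_L2: "comb c \<in> L2_I W" for c unfolding comb_def by (intro sum_in_L2_I L2) simp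
  have J0: "0 \<le> J (comb c)" for c
    unfolding J_def by (intro integral_nonneg_AE AE_I2 Lam_bounds(1)[OF comb_L2])
  define U where "U = J ` slepian_sphere \<psi> L"
  have bdd: "bdd_below U" using J0 by (auto simp: U_def sphere intro!: bdd_belowI[of _ 0])
  have "comb (\<lambda>n. if n = 0 then complex_of_real (1 / sqrt (a 0)) else 0) \<in> slepian_sphere \<psi> L"
  proof -
    have "(\<Sum>n\<le>L. (norm (if n = 0 then complex_of_real (1 / sqrt (a 0)) else 0))\<^sup>2 * a n) =
        (\<Sum>n\<le>L. if n = 0 then 1 else 0)"
      using a[of 0] by (intro sum.cong) (auto simp: norm_divide power_divide)
    then show ?thesis unfolding sphere by (intro exI conjI[OF refl]) simp
  qed
  then have ne: "U \<noteq> {}" by (auto simp: U_def)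
  have "\<exists>c. (\<Sum>n\<le>L. (norm (c n))\<^sup>2 * a n) = 1 \<and> J (comb c) < Inf U + inverse (real (Suc k))" for k
  proof -
    obtain u where "u \<in> U" "u < Inf U + inverse (real (Suc k))"
      using cInf_lessD[OF ne, of "Inf U + inverse (real (Suc k))"] by auto
    then show ?thesis by (auto simp: U_def sphere)
  qed
  then obtain c where c1: "\<And>k. (\<Sum>n\<le>L. (norm (c k n))\<^sup>2 * a n) = 1"
    and cJ: "\<And>k. J (comb (c k)) < Inf U + inverse (real (Suc k))"
    by metis
  have lower: "Inf U \<le> J (comb b)" if "(\<Sum>n\<le>L. (norm (b n))\<^sup>2 * a n) = 1" for b
  proof (rule cInf_lower[OF _ bdd])
    have "comb b \<in> slepian_sphere \<psi> L" using that sphere by blast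
    then show "J (comb b) \<in> U" by (simp add: U_def)
  qed
  have "(\<lambda>k. J (comb (c k))) \<longlonglongrightarrow> Inf U"
  proof (rule tendsto_sandwich[where f = "\<lambda>_. Inf U"])
    show "(\<lambda>k. Inf U + inverse (real (Suc k))) \<longlonglongrightarrow> Inf U"
      using tendsto_add[OF tendsto_const LIMSEQ_inverse_real_of_nat] by simp
    show "\<forall>\<^sub>F k in sequentially. J (comb (c k)) \<le> Inf U + inverse (real (Suc k))"
      using cJ by (simp add: less_imp_le)
    show "\<forall>\<^sub>F k in sequentially. Inf U \<le> J (comb (c k))"
      using lower c1 by simp
  qed simp
  moreover
  have "bounded (range (\<lambda>k. c k n))" if "n \<in> {..L}" for n
  proof -
    have "norm (c k n) \<le> sqrt (1 / a n)" for k
    proof -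
      have "(norm (c k n))\<^sup>2 * a n \<le> (\<Sum>n\<le>L. (norm (c k n))\<^sup>2 * a n)"
        using that by (intro member_le_sum) (simp_all add: less_imp_le[OF a])
      then show ?thesis using a[of n] c1 by (intro real_le_rsqrt) (simp add: field_simps)
    qed
    then show ?thesis by (auto simp: bounded_iff)
  qed
  then obtain r d where r: "strict_mono (r :: nat \<Rightarrow> nat)"
    and d: "\<And>n. n \<in> {..L} \<Longrightarrow> (\<lambda>k. c (r k) n) \<longlonglongrightarrow> d n"
    using coordinatewise_convergent_subsequence[of "{..L}" c] by auto
  ultimately have "(\<lambda>k. J (comb (c (r k)))) \<longlonglongrightarrow> Inf U"
    using LIMSEQ_subseq_LIMSEQ[of "\<lambda>k. J (comb (c k))" "Inf U" r] by (simp add: o_def)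
  then have Jd: "J (comb d) \<le> Inf U"
    unfolding J_def comb_def by (intro integral_Lam_lower_semicontinuous[OF _ L2 d]) auto
  have d_sphere: "comb d \<in> slepian_sphere \<psi> L"
  proof -
    have "(\<lambda>k. \<Sum>n\<le>L. (norm (c (r k) n))\<^sup>2 * a n) \<longlonglongrightarrow> (\<Sum>n\<le>L. (norm (d n))\<^sup>2 * a n)"
      using d by (intro tendsto_intros)
    then have "(\<Sum>n\<le>L. (norm (d n))\<^sup>2 * a n) = 1" by (simp add: c1 LIMSEQ_const_iff)
    then show ?thesis unfolding sphere by blast
  qed
  have "J (comb d) \<le> J B" if "B \<in> slepian_sphere \<psi> L" for B
  proof -
    have "J B \<in> U" using that by (simp add: U_def)
    then have "Inf U \<le> J B" by (rule cInf_lower[OF _ bdd])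
    with Jd show ?thesis by (rule order_trans)
  qed
  then show ?thesis using d_sphere unfolding J_def by blast
qed

theorem mainTheorem3:
  fixes W \<gamma> p :: real and L :: nat and \<psi> :: "nat \<Rightarrow> real \<Rightarrow> real"
  assumes "W \<ge> 1" and "\<gamma> \<ge> 1" and "p \<ge> 1"
    and "slepian_basis W \<psi>"
  shows "Lam \<gamma> ` slepian_sphere \<psi> L \<subseteq> Lp_space p Omega \<and>
    (\<exists>C\<in>slepian_sphere \<psi> L. pareto_optimal Omega (Lam \<gamma> ` slepian_sphere \<psi> L) (Lam \<gamma> C))"
proof -
  have L2: "C \<in> L2_I W" if C: "C \<in> slepian_sphere \<psi> L" for C
  proof -
    have "(\<lambda>t. complex_of_real (\<psi> n t)) \<in> L2_I W" for n
      using assms(4) by (auto simp: slepian_basis_def)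
    then show ?thesis
      using C sum_in_L2_I[of "{..L}"] by (auto simp: slepian_sphere_def slepian_span_def)
  qed
  obtain C where C: "C \<in> slepian_sphere \<psi> L"
    and min: "\<And>B. B \<in> slepian_sphere \<psi> L \<Longrightarrow> (LINT x|Omega. Lam \<gamma> C x) \<le> (LINT x|Omega. Lam \<gamma> B x)"
    using exists_Lam_integral_minimiser[OF assms(4)] by blast
  have "pareto_optimal Omega (Lam \<gamma> ` slepian_sphere \<psi> L) (Lam \<gamma> C)"
    using C min by (intro pareto_optimal_if_integral_minimal imageI)
      (blast intro: Lam_integrable L2)+
  moreover have "Lam \<gamma> ` slepian_sphere \<psi> L \<subseteq> Lp_space p Omega"
    using assms(3) by (intro image_subsetI Lam_in_Lp_space[OF L2]) simp_all
  ultimately show ?thesis using C by blast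
qed

end
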